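(* Let $G_1,G_2$ be graphs and let $G=G_1\dot\cup G_2$ be their disjoint union. Then $$\operatorname{th}_{\gamma_P}(G)\ge\max\{\gamma_P(G_1)+\operatorname{th}_{\gamma_P}(G_2),\ \gamma_P(G_2)+\operatorname{th}_{\gamma_P}(G_1)\},$$ $$\operatorname{th}_{\gamma_P}(G)\le\gamma_P(G_1)+\gamma_P(G_2)+\max\{\operatorname{ppt}(G_1),\operatorname{ppt}(G_2)\},$$ and these bounds are tight (each is attained with equality by some $G_1,G_2$).
   Context: All graphs are finite, simple, undirected, and have at least one vertex. For $S\subseteq V(G)$, $N[S]$ is the set of vertices in $S$ or adjacent to a vertex of $S$. Given $G=(V,E)$ and $S\subseteq V$, initially (timestep $0$) the vertices of $S$ are colored; in timestep $1$ every vertex in $N[S]$ becomes colored; in each subsequent timestep, every vertex which is the only non-colored neighbor of some colored vertex becomes colored. $S$ is a power dominating set if all vertices eventually become colored, and then $\operatorname{ppt}(G;S)$ is the number of timesteps needed to color all of $G$ (so $\operatorname{ppt}(G;V)=0$). The power domination number $\gamma_P(G)$ is the minimum cardinality of a power dominating set of $G$; $\operatorname{ppt}(G)=\min\{\operatorname{ppt}(G;S): S\text{ a power dominating set of }G\text{ with }|S|=\gamma_P(G)\}$; and the power domination throttling number is $\operatorname{th}_{\gamma_P}(G)=\min\{|S|+\operatorname{ppt}(G;S): S \text{ a power dominating set of } G\}$. *)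

theory Defs
  imports "Graph_Theory.Pair_Digraph"
begin

text \<open>
  An undirected edge between \<open>u\<close> and \<open>v\<close> is represented by the two arcs
  \<open>(u, v)\<close> and \<open>(v, u)\<close>; \<^locale>\<open>pair_graph\<close> requires finiteness, symmetry and the
  absence of loops, but allows the vertex set to be empty.
\<close>

definition simple_graph :: "'a pair_pre_digraph \<Rightarrow> bool" where
  "simple_graph G \<longleftrightarrow> pair_graph G \<and> pverts G \<noteq> {}"

definition nbhd :: "'a pair_pre_digraph \<Rightarrow> 'a \<Rightarrow> 'a set" where
  "nbhd G u = {v. (u, v) \<in> parcs G}"

definition closed_nbhd :: "'a pair_pre_digraph \<Rightarrow> 'a set \<Rightarrow> 'a set" where
  "closed_nbhd G S = S \<union> (\<Union>u\<in>S. nbhd G u)"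

text \<open>Time step 1 is the domination step; every later time step is a zero forcing step.\<close>

fun colored :: "'a pair_pre_digraph \<Rightarrow> 'a set \<Rightarrow> nat \<Rightarrow> 'a set" where
  "colored G S 0 = S"
| "colored G S (Suc 0) = closed_nbhd G S"
| "colored G S (Suc (Suc t)) =
     colored G S (Suc t) \<union>
     {v. \<exists>u \<in> colored G S (Suc t). nbhd G u - colored G S (Suc t) = {v}}"

definition power_dominating :: "'a pair_pre_digraph \<Rightarrow> 'a set \<Rightarrow> bool" where
  "power_dominating G S \<longleftrightarrow> S \<subseteq> pverts G \<and> (\<exists>t. colored G S t = pverts G)"

definition ppt_set :: "'a pair_pre_digraph \<Rightarrow> 'a set \<Rightarrow> nat" where
  "ppt_set G S = (LEAST t. colored G S t = pverts G)"

definition power_dom_num :: "'a pair_pre_digraph \<Rightarrow> nat" where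
  "power_dom_num G = Min {card S |S. power_dominating G S}"

definition ppt :: "'a pair_pre_digraph \<Rightarrow> nat" where
  "ppt G = Min {ppt_set G S |S. power_dominating G S \<and> card S = power_dom_num G}"

definition power_dom_throttling :: "'a pair_pre_digraph \<Rightarrow> nat" where
  "power_dom_throttling G = Min {card S + ppt_set G S |S. power_dominating G S}"

definition disjoint_union ::
    "'a pair_pre_digraph \<Rightarrow> 'b pair_pre_digraph \<Rightarrow> ('a + 'b) pair_pre_digraph" where
  "disjoint_union G H =
     \<lparr> pverts = pverts G <+> pverts H,
       parcs = map_prod Inl Inl ` parcs G \<union> map_prod Inr Inr ` parcs H \<rparr>"

lemma simple_graph_disjoint_union:
  assumes "simple_graph G" "simple_graph H"
  shows "simple_graph (disjoint_union G H)"
proof -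
  interpret G: pair_graph G using assms(1) by (simp add: simple_graph_def)
  interpret H: pair_graph H using assms(2) by (simp add: simple_graph_def)
  have "pair_graph (disjoint_union G H)"
  proof
    show "symmetric (with_proj (disjoint_union G H))"
      by (auto simp: symmetric_def disjoint_union_def sym_def image_iff Bex_def
          dest: G.arcs_symmetric H.arcs_symmetric)
  qed (auto simp: disjoint_union_def G.pair_finite_verts G.pair_finite_arcs
      H.pair_finite_verts H.pair_finite_arcs
      dest: G.wellformed' H.wellformed' G.no_loops' H.no_loops')
  then show ?thesis
    using assms by (auto simp: simple_graph_def disjoint_union_def)
qed

text \<open>The minima above range over finite non-empty sets.\<close>

lemma power_dominating_pverts: "power_dominating G (pverts G)"
  and ppt_set_pverts: "ppt_set G (pverts G) = 0"
proof -
  have "colored G (pverts G) 0 = pverts G" by simp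
  then show "power_dominating G (pverts G)" "ppt_set G (pverts G) = 0"
    unfolding power_dominating_def ppt_set_def by (blast, simp)
qed

lemma finite_power_dominating:
  assumes "simple_graph G"
  shows "finite {S. power_dominating G S}"
proof -
  have "finite (pverts G)"
    using assms by (simp add: simple_graph_def pair_graph_def pair_digraph_def
        pair_fin_digraph_def pair_fin_digraph_axioms_def)
  then show ?thesis
    by (rule finite_subset[rotated, OF finite_Pow_iff[THEN iffD2]])
      (auto simp: power_dominating_def)
qed

end

theory Submission
  imports Defs
begin

text \<open>
  Coloring proceeds independently in the two components, so the power dominating sets of
  the disjoint union are exactly the sums of power dominating sets \<open>S\<close>, \<open>T\<close> of the two graphs,
  and the propagation time of such a sum is the maximum of those of \<open>S\<close> and \<open>T\<close>. Both bounds
  follow, and for two isolated vertices both equal 2, which forces equality.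
\<close>

section \<open>Coloring and propagation time in a single graph\<close>

lemma colored_subset_pverts:
  assumes "simple_graph G" "S \<subseteq> pverts G"
  shows "colored G S t \<subseteq> pverts G"
proof -
  interpret pair_graph G using assms(1) by (simp add: simple_graph_def)
  show ?thesis
    using assms(2)
    \<comment> \<open>The three cases match the equations of \<open>colored\<close>: initial set,
      domination step, forcing step.\<close>
    by (induction t rule: induct_nat_012)
      (auto simp: closed_nbhd_def nbhd_def dest: wellformed')
qed

lemma colored_mono: "s \<le> t \<Longrightarrow> colored G S s \<subseteq> colored G S t"
proof (rule lift_Suc_mono_le[of "colored G S"])
  show "colored G S n \<subseteq> colored G S (Suc n)" for n
    by (cases n) (auto simp: closed_nbhd_def)
qed

text \<open>The colored set only grows and never leaves \<open>pverts G\<close>, so once it is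
  everything it stays everything. This turns an equation at time \<open>t\<close> into a threshold
  condition on \<open>t\<close>.\<close>

lemma colored_eq_pverts_iff:
  assumes "simple_graph G" "power_dominating G S"
  shows "colored G S t = pverts G \<longleftrightarrow> ppt_set G S \<le> t"
proof
  assume "colored G S t = pverts G"
  then show "ppt_set G S \<le> t" unfolding ppt_set_def by (rule Least_le)
next
  assume "ppt_set G S \<le> t"
  then have "colored G S (ppt_set G S) \<subseteq> colored G S t" by (rule colored_mono)
  moreover have "colored G S (ppt_set G S) = pverts G"
    using assms(2) LeastI_ex[of "\<lambda>t. colored G S t = pverts G"]
    unfolding ppt_set_def power_dominating_def by blast
  moreover have "colored G S t \<subseteq> pverts G"
    using assms by (simp add: colored_subset_pverts power_dominating_def)
  ultimately show "colored G S t = pverts G" by blast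
qed

lemma colored_empty: "colored G {} t = {}"
  by (induction t rule: induct_nat_012) (auto simp: closed_nbhd_def)

section \<open>Coloring and power domination in a disjoint union\<close>

lemma nbhd_disjoint_union:
  "nbhd (disjoint_union G H) (Inl x) = Inl ` nbhd G x"
  "nbhd (disjoint_union G H) (Inr y) = Inr ` nbhd H y"
  by (force simp: nbhd_def disjoint_union_def)+

lemma inj_image_eq_singleton_iff:
  assumes "inj f"
  shows "f ` X = {v} \<longleftrightarrow> (\<exists>w. v = f w \<and> X = {w})"
proof
  assume "f ` X = {v}"
  moreover from this obtain w where "v = f w" by blast
  ultimately have "f ` X = f ` {w}" by simp
  with \<open>v = f w\<close> show "\<exists>w. v = f w \<and> X = {w}"
    using assms by (blast dest: inj_image_eq_iff[THEN iffD1])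
qed auto

text \<open>The neighborhood of a vertex stays within its own summand, so its uncolored part is an
  image under \<open>Inl\<close> or \<open>Inr\<close>. Injectivity then reduces "exactly one
  uncolored neighbor" to the summand.\<close>

lemma forced_disjoint_union:
  "{v. \<exists>u \<in> A <+> B. nbhd (disjoint_union G H) u - (A <+> B) = {v}} =
    {v. \<exists>u \<in> A. nbhd G u - A = {v}} <+> {v. \<exists>u \<in> B. nbhd H u - B = {v}}"
proof -
  have "Inl ` X - (A <+> B) = Inl ` (X - A)" "Inr ` Y - (A <+> B) = Inr ` (Y - B)" for X Y
    by auto
  moreover have "(\<exists>u \<in> A <+> B. P u) \<longleftrightarrow> (\<exists>x\<in>A. P (Inl x)) \<or> (\<exists>y\<in>B. P (Inr y))" for P
    by auto
  ultimately show ?thesis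
    by (simp add: nbhd_disjoint_union inj_image_eq_singleton_iff) blast
qed

lemma colored_disjoint_union:
  "colored (disjoint_union G H) (S <+> T) t = colored G S t <+> colored H T t"
proof (induction t rule: induct_nat_012)
  case 0
  show ?case by simp
next
  case 1
  show ?case
    by (auto simp: closed_nbhd_def nbhd_disjoint_union)
next
  case (ge2 n)
  show ?case
    by (simp only: colored.simps ge2 forced_disjoint_union) auto
qed

lemma colored_disjoint_union_eq_iff:
  "colored (disjoint_union G H) (S <+> T) t = pverts (disjoint_union G H) \<longleftrightarrow>
    colored G S t = pverts G \<and> colored H T t = pverts H"
proof -
  have "A <+> B = C <+> D \<longleftrightarrow> A = C \<and> B = D" for A C :: "'a set" and B D :: "'b set"
    by (auto simp: set_eq_iff split_sum_all)
  then show ?thesis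
    by (simp add: colored_disjoint_union) (simp add: disjoint_union_def)
qed

lemma power_dominating_disjoint_union:
  assumes "simple_graph G" "simple_graph H"
  shows "power_dominating (disjoint_union G H) (S <+> T) \<longleftrightarrow>
    power_dominating G S \<and> power_dominating H T" (is "?L \<longleftrightarrow> ?R")
proof
  assume ?L
  then show ?R
    unfolding power_dominating_def colored_disjoint_union_eq_iff
    by (auto simp: disjoint_union_def)
next
  assume R: ?R
  \<comment> \<open>The two graphs may finish at different times; at the later one both are fully
    colored.\<close>
  then have "colored (disjoint_union G H) (S <+> T) (max (ppt_set G S) (ppt_set H T)) =
      pverts (disjoint_union G H)"
    using assms by (simp add: colored_disjoint_union_eq_iff colored_eq_pverts_iff)
  moreover have "S <+> T \<subseteq> pverts (disjoint_union G H)"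
    using R unfolding power_dominating_def disjoint_union_def by auto
  ultimately show ?L
    unfolding power_dominating_def by blast
qed

text \<open>Being fully colored is a threshold condition on \<open>t\<close> in each summand, and
  two lower bounds on \<open>t\<close> amount to one bound by their maximum.\<close>

lemma ppt_set_disjoint_union:
  assumes "simple_graph G" "simple_graph H" "power_dominating G S" "power_dominating H T"
  shows "ppt_set (disjoint_union G H) (S <+> T) = max (ppt_set G S) (ppt_set H T)"
proof -
  have "ppt_set (disjoint_union G H) (S <+> T) = (LEAST t. max (ppt_set G S) (ppt_set H T) \<le> t)"
    unfolding ppt_set_def[of "disjoint_union G H"] colored_disjoint_union_eq_iff
    using assms by (simp add: colored_eq_pverts_iff)
  also have "\<dots> = max (ppt_set G S) (ppt_set H T)"
    by (rule Least_equality) simp_all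
  finally show ?thesis .
qed

text \<open>Any subset of a sum type is the sum of its preimages under \<open>Inl\<close> and
  \<open>Inr\<close>, so treating sets of the form \<open>S <+> T\<close> loses no
  generality.\<close>

lemma power_dominating_disjoint_unionE:
  assumes "simple_graph G" "simple_graph H" "power_dominating (disjoint_union G H) U"
  obtains S T where "U = S <+> T" "power_dominating G S" "power_dominating H T"
proof -
  have "U = (Inl -` U) <+> (Inr -` U)"
    by (auto simp: set_eq_iff split_sum_all)
  moreover from this have "power_dominating (disjoint_union G H) ((Inl -` U) <+> (Inr -` U))"
    using assms(3) by simp
  ultimately show thesis
    using that power_dominating_disjoint_union[OF assms(1,2)] by blast
qed

section \<open>The three parameters as attained minima\<close>

lemma finite_if_power_dominating:
  assumes "simple_graph G" "power_dominating G S"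
  shows "finite S"
proof -
  interpret pair_graph G using assms(1) by (simp add: simple_graph_def)
  show ?thesis
    using assms(2) pair_finite_verts by (auto simp: power_dominating_def intro: finite_subset)
qed

text \<open>The predicate \<open>P\<close> lets one statement serve both the minima over all power
  dominating sets and the one in \<open>ppt\<close>, which fixes the cardinality.\<close>

lemma finite_image_power_dominating:
  assumes "simple_graph G"
  shows "finite {f S |S. power_dominating G S \<and> P S}"
  using finite_power_dominating[OF assms] by simp

lemma power_dom_num_le:
  assumes "simple_graph G" "power_dominating G S"
  shows "power_dom_num G \<le> card S"
  unfolding power_dom_num_def
  using finite_image_power_dominating[OF assms(1), of card "\<lambda>_. True"] assms(2)
  by (intro Min_le) auto

text \<open>\<open>Min\<close> is a member of the set because that set is finite and contains the
  cardinality of \<open>pverts G\<close>.\<close>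

lemma power_dom_num_attained:
  assumes "simple_graph G"
  obtains S where "power_dominating G S" "card S = power_dom_num G"
proof -
  have "power_dom_num G \<in> {card S |S. power_dominating G S}"
    unfolding power_dom_num_def
    using finite_image_power_dominating[OF assms, of card "\<lambda>_. True"]
      power_dominating_pverts[of G]
    by (intro Min_in) auto
  then show thesis using that by auto
qed

lemma ppt_le:
  assumes "simple_graph G" "power_dominating G S" "card S = power_dom_num G"
  shows "ppt G \<le> ppt_set G S"
  unfolding ppt_def
  using finite_image_power_dominating[OF assms(1)] assms(2,3)
  by (intro Min_le) auto

lemma ppt_attained:
  assumes "simple_graph G"
  obtains S where "power_dominating G S" "card S = power_dom_num G" "ppt_set G S = ppt G"
proof -
  \<comment> \<open>Here nonemptiness needs a power dominating set of minimum size, which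
    \<open>pverts G\<close> need not be.\<close>
  obtain S where S: "power_dominating G S" "card S = power_dom_num G"
    using assms by (rule power_dom_num_attained)
  have "ppt G \<in> {ppt_set G S |S. power_dominating G S \<and> card S = power_dom_num G}"
    unfolding ppt_def
    using finite_image_power_dominating[OF assms] S
    by (intro Min_in) auto
  then show thesis using that by auto
qed

lemma power_dom_throttling_le:
  assumes "simple_graph G" "power_dominating G S"
  shows "power_dom_throttling G \<le> card S + ppt_set G S"
  unfolding power_dom_throttling_def
  using finite_image_power_dominating[OF assms(1), of _ "\<lambda>_. True"] assms(2)
  by (intro Min_le) auto

lemma power_dom_throttling_attained:
  assumes "simple_graph G"
  obtains S where "power_dominating G S" "card S + ppt_set G S = power_dom_throttling G"
proof -
  have "power_dom_throttling G \<in> {card S + ppt_set G S |S. power_dominating G S}"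
    unfolding power_dom_throttling_def
    using finite_image_power_dominating[OF assms, of _ "\<lambda>_. True"]
      power_dominating_pverts[of G]
    by (intro Min_in) auto
  then show thesis using that by auto
qed

section \<open>The lower and the upper bound\<close>

lemma power_dom_throttling_disjoint_union_ge:
  assumes "simple_graph G" "simple_graph H"
  shows "max (power_dom_num G + power_dom_throttling H)
      (power_dom_num H + power_dom_throttling G) \<le> power_dom_throttling (disjoint_union G H)"
proof -
  obtain U where U: "power_dominating (disjoint_union G H) U"
    "card U + ppt_set (disjoint_union G H) U = power_dom_throttling (disjoint_union G H)"
    using assms power_dom_throttling_attained simple_graph_disjoint_union by metis
  obtain S T where ST: "U = S <+> T" "power_dominating G S" "power_dominating H T"
    using assms U(1) by (rule power_dominating_disjoint_unionE)
  have "card U = card S + card T"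
    using assms ST by (simp add: card_Plus finite_if_power_dominating)
  moreover have "ppt_set (disjoint_union G H) U = max (ppt_set G S) (ppt_set H T)"
    using assms ST by (simp add: ppt_set_disjoint_union)
  moreover have "power_dom_num G \<le> card S" "power_dom_num H \<le> card T"
    "power_dom_throttling G \<le> card S + ppt_set G S"
    "power_dom_throttling H \<le> card T + ppt_set H T"
    using assms ST by (auto intro: power_dom_num_le power_dom_throttling_le)
  \<comment> \<open>The cost of \<open>U\<close> is \<open>card S + card T\<close> plus the larger
    time. Bounding one cardinality by the power domination number, and the larger time from below by
    the time of the other summand, gives each entry of the maximum.\<close>
  ultimately show ?thesis
    using U(2) by linarith
qed

text \<open>Minimum power dominating sets of the summands, each chosen with the fastest propagation,
  combine to a set whose cost is the right-hand side.\<close>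

lemma power_dom_throttling_disjoint_union_le:
  assumes "simple_graph G" "simple_graph H"
  shows "power_dom_throttling (disjoint_union G H) \<le>
    power_dom_num G + power_dom_num H + max (ppt G) (ppt H)"
proof -
  obtain S where S: "power_dominating G S" "card S = power_dom_num G" "ppt_set G S = ppt G"
    using assms(1) by (rule ppt_attained)
  obtain T where T: "power_dominating H T" "card T = power_dom_num H" "ppt_set H T = ppt H"
    using assms(2) by (rule ppt_attained)
  have "power_dom_throttling (disjoint_union G H) \<le>
      card (S <+> T) + ppt_set (disjoint_union G H) (S <+> T)"
    using assms S(1) T(1)
    by (intro power_dom_throttling_le)
      (simp_all add: simple_graph_disjoint_union power_dominating_disjoint_union)
  then show ?thesis
    using assms S T by (simp add: card_Plus finite_if_power_dominating ppt_set_disjoint_union)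
qed

section \<open>Tightness\<close>

lemma power_dom_num_pos:
  assumes "simple_graph G"
  shows "0 < power_dom_num G"
proof -
  obtain S where S: "power_dominating G S" "card S = power_dom_num G"
    using assms by (rule power_dom_num_attained)
  \<comment> \<open>The empty set never colors anything, while there is a vertex to color.\<close>
  then have "S \<noteq> {}"
    using assms by (auto simp: power_dominating_def colored_empty simple_graph_def)
  then show ?thesis
    using S assms by (metis card_gt_0_iff finite_if_power_dominating)
qed

lemma power_dom_num_le_throttling:
  assumes "simple_graph G"
  shows "power_dom_num G \<le> power_dom_throttling G"
  using assms power_dom_throttling_attained power_dom_num_le by (metis trans_le_add1)

lemma single_vertex_parameters:
  fixes x :: 'a
  defines "K \<equiv> \<lparr> pverts = {x}, parcs = {} \<rparr>"
  shows "simple_graph K" "power_dom_num K = 1" "power_dom_throttling K = 1" "ppt K = 0"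
proof -
  have "pair_graph K"
  proof
    show "symmetric (with_proj K)"
      by (simp add: K_def symmetric_def sym_def)
  qed (auto simp: K_def)
  then show K: "simple_graph K"
    by (simp add: simple_graph_def K_def)
  have 1: "power_dominating K {x}" "ppt_set K {x} = 0"
    using power_dominating_pverts[of K] ppt_set_pverts[of K] by (simp_all add: K_def)
  \<comment> \<open>Positivity gives the lower bound, the set \<open>{x}\<close> the upper
    one.\<close>
  show num: "power_dom_num K = 1"
    using power_dom_num_pos[OF K] power_dom_num_le[OF K 1(1)] by simp
  show "power_dom_throttling K = 1"
    using num power_dom_num_le_throttling[OF K] power_dom_throttling_le[OF K 1(1)] 1(2) by simp
  show "ppt K = 0"
    using ppt_le[OF K 1(1)] num 1(2) by simp
qed

theorem proposition8:
  shows
    "(\<forall>(G\<^sub>1 :: 'a pair_pre_digraph) (G\<^sub>2 :: 'b pair_pre_digraph).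
        simple_graph G\<^sub>1 \<and> simple_graph G\<^sub>2 \<longrightarrow>
          power_dom_throttling (disjoint_union G\<^sub>1 G\<^sub>2)
            \<ge> max (power_dom_num G\<^sub>1 + power_dom_throttling G\<^sub>2)
                   (power_dom_num G\<^sub>2 + power_dom_throttling G\<^sub>1) \<and>
          power_dom_throttling (disjoint_union G\<^sub>1 G\<^sub>2)
            \<le> power_dom_num G\<^sub>1 + power_dom_num G\<^sub>2 + max (ppt G\<^sub>1) (ppt G\<^sub>2)) \<and>
     (\<exists>(H\<^sub>1 :: nat pair_pre_digraph) (H\<^sub>2 :: nat pair_pre_digraph).
        simple_graph H\<^sub>1 \<and> simple_graph H\<^sub>2 \<and>
          power_dom_throttling (disjoint_union H\<^sub>1 H\<^sub>2)
            = max (power_dom_num H\<^sub>1 + power_dom_throttling H\<^sub>2)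
                  (power_dom_num H\<^sub>2 + power_dom_throttling H\<^sub>1)) \<and>
     (\<exists>(H\<^sub>1 :: nat pair_pre_digraph) (H\<^sub>2 :: nat pair_pre_digraph).
        simple_graph H\<^sub>1 \<and> simple_graph H\<^sub>2 \<and>
          power_dom_throttling (disjoint_union H\<^sub>1 H\<^sub>2)
            = power_dom_num H\<^sub>1 + power_dom_num H\<^sub>2 + max (ppt H\<^sub>1) (ppt H\<^sub>2))"
proof -
  define K :: "nat pair_pre_digraph" where "K = \<lparr> pverts = {0}, parcs = {} \<rparr>"
  note K = single_vertex_parameters[of "0 :: nat", folded K_def]
  \<comment> \<open>The lower bound is \<open>1 + 1\<close> and the upper bound
    \<open>1 + 1 + 0\<close>, so one example settles both equalities.\<close>
  have "power_dom_throttling (disjoint_union K K) = 2"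
    using power_dom_throttling_disjoint_union_ge[OF K(1) K(1)]
      power_dom_throttling_disjoint_union_le[OF K(1) K(1)] K by simp
  then have
    "power_dom_throttling (disjoint_union K K)
      = max (power_dom_num K + power_dom_throttling K) (power_dom_num K + power_dom_throttling K)"
    "power_dom_throttling (disjoint_union K K)
      = power_dom_num K + power_dom_num K + max (ppt K) (ppt K)"
    using K by simp_all
  then show ?thesis
    using K(1) power_dom_throttling_disjoint_union_ge power_dom_throttling_disjoint_union_le
    by blast
qed

end
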